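(* Let $f:\mathbb{R}^n\to\mathbb{R}^n$ be a function, $F:\mathbb{R}^n\rightrightarrows\mathbb{R}^n$ a set-valued map and $p:[0,1]\to\mathbb{R}^n$ a function. For $t\in[0,1]$ let $G_t(v)=f(v)-p(t)+F(v)$ and $S(t)=\{z\in\mathbb{R}^n : 0\in G_t(z)\}$. Assume that (i) $z:[0,1]\to\mathbb{R}^n$ is a continuous solution trajectory, i.e. $z$ is continuous and $z(t)\in S(t)$ for all $t\in[0,1]$; (ii) $p$ is continuous; (iii) for every $t\in[0,1]$, $G_t$ is strongly metrically regular at $z(t)$ for $0$. Then there exist constants $a,b,\kappa>0$ such that for every $t\in[0,1]$ the mapping $$\mathbb{B}_b(0)\ni y\longmapsto G_t^{-1}(y)\cap\mathbb{B}_a(z(t))$$ is single-valued and Lipschitz continuous with Lipschitz constant $\kappa$.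
   Context: For a set-valued map $H:\mathbb{R}^n\rightrightarrows\mathbb{R}^n$, $H^{-1}(y)=\{x: y\in H(x)\}$. $\mathbb{B}_r(x)$ denotes the closed ball of radius $r$ centred at $x$. "Single-valued" means that the set has exactly one element for each $y$ in the indicated ball. $G_t$ is strongly metrically regular at $z(t)$ for $0$ if $0\in G_t(z(t))$ and there exist constants $a_t,b_t,\kappa_t>0$ (possibly depending on $t$) such that the mapping $\mathbb{B}_{b_t}(0)\ni y\mapsto G_t^{-1}(y)\cap\mathbb{B}_{a_t}(z(t))$ is single-valued and Lipschitz continuous with Lipschitz constant $\kappa_t$. *)

theory Defs
  imports "HOL-Analysis.Analysis"
begin

text \<open>Set-valued maps are rendered as functions into sets, with the empty set as an admissible value.\<close>

definition inv_map :: "('a \<Rightarrow> 'b set) \<Rightarrow> 'b \<Rightarrow> 'a set" where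
  "inv_map H y = {x. y \<in> H x}"

definition perturbed_map ::
    "('a \<Rightarrow> 'b) \<Rightarrow> (real \<Rightarrow> 'b) \<Rightarrow> ('a \<Rightarrow> 'b set) \<Rightarrow> real \<Rightarrow> 'a \<Rightarrow> 'b::ab_group_add set" where
  "perturbed_map f p F t v = {f v - p t + w | w. w \<in> F v}"

definition solution_set ::
    "('a \<Rightarrow> 'b::ab_group_add) \<Rightarrow> (real \<Rightarrow> 'b) \<Rightarrow> ('a \<Rightarrow> 'b set) \<Rightarrow> real \<Rightarrow> 'a set" where
  "solution_set f p F t = {z. 0 \<in> perturbed_map f p F t z}"

definition single_valued_lipschitz_on ::
    "real \<Rightarrow> 'b::metric_space set \<Rightarrow> ('b \<Rightarrow> 'a::metric_space set) \<Rightarrow> bool" where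
  "single_valued_lipschitz_on \<kappa> B \<Phi> \<longleftrightarrow>
     (\<forall>y\<in>B. \<exists>!x. x \<in> \<Phi> y) \<and> \<kappa>-lipschitz_on B (\<lambda>y. the_elem (\<Phi> y))"

definition strongly_metrically_regular ::
    "('a::metric_space \<Rightarrow> 'b::metric_space set) \<Rightarrow> 'a \<Rightarrow> 'b \<Rightarrow> bool" where
  "strongly_metrically_regular H x y \<longleftrightarrow>
     y \<in> H x \<and>
     (\<exists>a>0. \<exists>b>0. \<exists>\<kappa>>0.
        single_valued_lipschitz_on \<kappa> (cball y b) (\<lambda>u. inv_map H u \<inter> cball x a))"

end

theory Submission
  imports Defs
begin

text \<open>Strong regularity at \<open>t\<close> is a property of the inverse of the \<open>t\<close>-independent map \<open>f + F\<close>
  around the point \<open>(p t, z t)\<close> of its graph. By continuity of \<open>p\<close> and \<open>z\<close>, the balls around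
  \<open>(p t, z t)\<close> that witness regularity contain balls of half the radius around \<open>(p s, z s)\<close> for
  all \<open>s\<close> near \<open>t\<close>. The single-valued branch passes through \<open>z s\<close> at \<open>p s\<close>, so its Lipschitz
  bound keeps it in a given ball around \<open>z s\<close> once the ball around \<open>p s\<close> is small enough.
  Compactness of \<open>[0,1]\<close> leaves finitely many triples of constants.\<close>

text \<open>Trades \<open>the_elem\<close> for an explicit branch \<open>g\<close>, which can be
  restricted to smaller balls.\<close>

lemma single_valued_lipschitz_on_iff:
  "single_valued_lipschitz_on \<kappa> B \<Phi> \<longleftrightarrow>
     (\<exists>g. (\<forall>y\<in>B. \<Phi> y = {g y}) \<and> \<kappa>-lipschitz_on B g)"
proof
  assume sv: "single_valued_lipschitz_on \<kappa> B \<Phi>"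
  have "\<Phi> y = {the_elem (\<Phi> y)}" if "y \<in> B" for y
  proof -
    have "\<exists>!x. x \<in> \<Phi> y"
      using sv that by (simp only: single_valued_lipschitz_on_def)
    then have "\<exists>x. \<Phi> y = {x}"
      unfolding set_eq_iff singleton_iff by metis
    then show ?thesis by force
  qed
  moreover have "\<kappa>-lipschitz_on B (\<lambda>y. the_elem (\<Phi> y))"
    using sv unfolding single_valued_lipschitz_on_def ..
  ultimately show "\<exists>g. (\<forall>y\<in>B. \<Phi> y = {g y}) \<and> \<kappa>-lipschitz_on B g"
    by (intro exI[of _ "\<lambda>y. the_elem (\<Phi> y)"] conjI ballI)
next
  assume "\<exists>g. (\<forall>y\<in>B. \<Phi> y = {g y}) \<and> \<kappa>-lipschitz_on B g"
  then obtain g where g: "\<And>y. y \<in> B \<Longrightarrow> \<Phi> y = {g y}" and lip: "\<kappa>-lipschitz_on B g"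
    by blast
  have "\<kappa>-lipschitz_on B (\<lambda>y. the_elem (\<Phi> y))"
    using lip by (rule lipschitz_on_transform) (simp add: g)
  then show "single_valued_lipschitz_on \<kappa> B \<Phi>"
    unfolding single_valued_lipschitz_on_def by (simp add: g)
qed

text \<open>Translation by \<open>q\<close> is an isometry carrying the ball around 0 onto the ball
  around \<open>q\<close>.\<close>

lemma single_valued_lipschitz_on_translate:
  fixes q :: "'b::real_normed_vector" and \<Phi> :: "'b \<Rightarrow> 'a::metric_space set"
  shows "single_valued_lipschitz_on \<kappa> (cball 0 b) (\<lambda>y. \<Phi> (y + q)) \<longleftrightarrow>
         single_valued_lipschitz_on \<kappa> (cball q b) \<Phi>"
proof -
  have mem: "y + q \<in> cball q b \<longleftrightarrow> y \<in> cball 0 b" for y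
    by (simp add: dist_norm)
  \<comment> \<open>Stated for arbitrary \<open>P\<close>, so that it rewrites both the uniqueness
    condition and the two nested ball quantifiers of the Lipschitz condition.\<close>
  have all: "(\<forall>y\<in>cball q b. P y) \<longleftrightarrow> (\<forall>y\<in>cball 0 b. P (y + q))" for P :: "'b \<Rightarrow> bool"
  proof (intro iffI ballI)
    fix y :: 'b
    assume "\<forall>y\<in>cball q b. P y" "y \<in> cball 0 b"
    then show "P (y + q)"
      using mem by blast
  next
    fix y :: 'b
    assume "\<forall>y\<in>cball 0 b. P (y + q)" "y \<in> cball q b"
    then show "P y"
      using mem[of "y - q"] by fastforce
  qed
  show ?thesis
    by (simp only: single_valued_lipschitz_on_def lipschitz_on_def all dist_add_cancel2)
qed

lemma cball_subset_cball_dist: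
  fixes x x' :: "'a::metric_space"
  assumes "dist x x' + a' \<le> a"
  shows "cball x' a' \<subseteq> cball x a"
proof
  fix y
  assume "y \<in> cball x' a'"
  then show "y \<in> cball x a"
    using dist_triangle[of x y x'] assms by simp
qed

lemma single_valued_lipschitz_on_recenter:
  fixes q q' :: "'b::metric_space" and \<Phi> :: "'b \<Rightarrow> 'a::metric_space set"
  assumes sv: "single_valued_lipschitz_on \<kappa> (cball q b) (\<lambda>y. \<Phi> y \<inter> cball x a)"
    and x': "x' \<in> \<Phi> q'"
    and q': "dist q q' + b' \<le> b" and xx': "dist x x' + a' \<le> a"
    and "0 \<le> a'" "0 \<le> b'" "\<kappa> \<le> \<kappa>'" "\<kappa>' * b' \<le> a'"
  shows "single_valued_lipschitz_on \<kappa>' (cball q' b') (\<lambda>y. \<Phi> y \<inter> cball x' a')"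
proof -
  obtain g where g: "\<And>y. y \<in> cball q b \<Longrightarrow> \<Phi> y \<inter> cball x a = {g y}"
    and lip: "\<kappa>-lipschitz_on (cball q b) g"
    using sv unfolding single_valued_lipschitz_on_iff by blast
  have sub_q: "cball q' b' \<subseteq> cball q b" and sub_x: "cball x' a' \<subseteq> cball x a"
    using q' xx' by (simp_all add: cball_subset_cball_dist)
  have lip': "\<kappa>'-lipschitz_on (cball q' b') g"
    using lipschitz_on_mono[OF lip sub_q \<open>\<kappa> \<le> \<kappa>'\<close>] .
  have q'_in: "q' \<in> cball q' b'" and "x' \<in> cball x' a'"
    using \<open>0 \<le> a'\<close> \<open>0 \<le> b'\<close> by simp_all
  then have "x' \<in> \<Phi> q' \<inter> cball x a" "q' \<in> cball q b"
    using x' sub_q sub_x by blast+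
  then have "g q' = x'"
    using g[of q'] by (metis singletonD)
  have "\<Phi> y \<inter> cball x' a' = {g y}" if y: "y \<in> cball q' b'" for y
  proof -
    have "dist x' (g y) \<le> \<kappa>' * dist q' y"
      using lipschitz_onD[OF lip' q'_in y] \<open>g q' = x'\<close> by simp
    also have "\<dots> \<le> \<kappa>' * b'"
      using y lipschitz_on_nonneg[OF lip'] by (simp add: mult_left_mono)
    finally have "g y \<in> cball x' a'"
      using \<open>\<kappa>' * b' \<le> a'\<close> by simp
    \<comment> \<open>Existence comes from \<open>g y\<close> lying in the small ball, uniqueness is
      inherited from the large one.\<close>
    then show ?thesis
      using g[of y] y sub_q sub_x by blast
  qed
  then show ?thesis
    unfolding single_valued_lipschitz_on_iff using lip' by blast
qed

text \<open>Since \<open>\<Phi>\<close> is the same for all \<open>t\<close>, the branch found at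
  \<open>t\<close> also passes through \<open>(p s, z s)\<close> for nearby \<open>s\<close>. Its
  constants, suitably shrunk, therefore serve a whole neighbourhood of \<open>t\<close>.\<close>

lemma single_valued_lipschitz_on_uniform:
  fixes p :: "'c::metric_space \<Rightarrow> 'b::metric_space"
    and z :: "'c \<Rightarrow> 'a::metric_space" and \<Phi> :: "'b \<Rightarrow> 'a set"
  assumes K: "compact K" and z: "continuous_on K z" and p: "continuous_on K p"
    and graph: "\<And>t. t \<in> K \<Longrightarrow> z t \<in> \<Phi> (p t)"
    and reg: "\<And>t. t \<in> K \<Longrightarrow> \<exists>a>0. \<exists>b>0. \<exists>\<kappa>>0.
      single_valued_lipschitz_on \<kappa> (cball (p t) b) (\<lambda>y. \<Phi> y \<inter> cball (z t) a)"
  shows "\<exists>a>0. \<exists>b>0. \<exists>\<kappa>>0. \<forall>t\<in>K.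
      single_valued_lipschitz_on \<kappa> (cball (p t) b) (\<lambda>y. \<Phi> y \<inter> cball (z t) a)"
proof -
  obtain A B L where pos: "\<And>t. t \<in> K \<Longrightarrow> A t > 0 \<and> B t > 0 \<and> L t > 0"
    and sv: "\<And>t. t \<in> K \<Longrightarrow>
      single_valued_lipschitz_on (L t) (cball (p t) (B t)) (\<lambda>y. \<Phi> y \<inter> cball (z t) (A t))"
    using reg by metis
  \<comment> \<open>Half of each radius is spent on moving the centre; the other half is left for
    the new ball.\<close>
  have "\<exists>d>0. \<forall>s\<in>K. dist s t < d \<longrightarrow> dist (z s) (z t) < A t / 2 \<and> dist (p s) (p t) < B t / 2"
    if t: "t \<in> K" for t
  proof -
    have "A t / 2 > 0" "B t / 2 > 0"
      using pos[OF t] by simp_all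
    then obtain d1 where "d1 > 0" "\<And>s. s \<in> K \<Longrightarrow> dist s t < d1 \<Longrightarrow> dist (z s) (z t) < A t / 2"
      using z t unfolding continuous_on_iff by blast
    moreover obtain d2 where "d2 > 0" "\<And>s. s \<in> K \<Longrightarrow> dist s t < d2 \<Longrightarrow> dist (p s) (p t) < B t / 2"
      using p t \<open>B t / 2 > 0\<close> unfolding continuous_on_iff by blast
    ultimately show ?thesis
      by (intro exI[of _ "min d1 d2"]) auto
  qed
  then obtain d where d: "\<And>t. t \<in> K \<Longrightarrow> d t > 0"
    and near: "\<And>s t. t \<in> K \<Longrightarrow> s \<in> K \<Longrightarrow> dist s t < d t \<Longrightarrow>
      dist (z s) (z t) < A t / 2 \<and> dist (p s) (p t) < B t / 2"
    by metis
  have "K \<subseteq> (\<Union>t\<in>K. ball t (d t))"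
    using d by force
  then obtain T where T: "T \<subseteq> K" "finite T" "K \<subseteq> (\<Union>t\<in>T. ball t (d t))"
    using compactE_image[OF K, of K "\<lambda>t. ball t (d t)"] by auto
  text \<open>The extra element 1 covers empty \<open>T\<close>.\<close>
  define a where "a = Min (insert 1 ((\<lambda>t. A t / 2) ` T))"
  define \<kappa> where "\<kappa> = Max (insert 1 (L ` T))"
  \<comment> \<open>The cap \<open>a / \<kappa>\<close> secures \<open>\<kappa> * b \<le> a\<close>,
    the smallness condition for recentering.\<close>
  define b where "b = Min (insert (a / \<kappa>) ((\<lambda>t. B t / 2) ` T))"
  have a_le: "a \<le> A t / 2" and b_le: "b \<le> B t / 2" and L_le: "L t \<le> \<kappa>" if "t \<in> T" for t
    unfolding a_def b_def \<kappa>_def using T(2) that by - (rule Min_le Max_ge; blast)+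
  have "a > 0"
    unfolding a_def using T pos by (subst Min_gr_iff) auto
  have "\<kappa> \<ge> 1"
    unfolding \<kappa>_def using T(2) by simp
  have "b > 0"
    unfolding b_def using T pos \<open>a > 0\<close> \<open>\<kappa> \<ge> 1\<close> by (subst Min_gr_iff) auto
  have "b \<le> a / \<kappa>"
    unfolding b_def using T(2) by simp
  then have "\<kappa> * b \<le> a"
    using \<open>\<kappa> \<ge> 1\<close> by (simp add: pos_le_divide_eq mult.commute)
  have "single_valued_lipschitz_on \<kappa> (cball (p s) b) (\<lambda>y. \<Phi> y \<inter> cball (z s) a)"
    if s: "s \<in> K" for s
  proof -
    obtain t where t: "t \<in> T" "dist s t < d t"
      using T(3) s by (auto simp: dist_commute)
    then have "t \<in> K"
      using T(1) by blast
    have near_t: "dist (p t) (p s) + b \<le> B t" "dist (z t) (z s) + a \<le> A t"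
      using near[OF \<open>t \<in> K\<close> s t(2)] a_le[OF t(1)] b_le[OF t(1)] by (simp_all add: dist_commute)
    show ?thesis
      using sv[OF \<open>t \<in> K\<close>] graph[OF s] near_t
      by (rule single_valued_lipschitz_on_recenter)
        (use \<open>a > 0\<close> \<open>b > 0\<close> L_le[OF t(1)] \<open>\<kappa> * b \<le> a\<close> in auto)
  qed
  then show ?thesis
    using \<open>a > 0\<close> \<open>b > 0\<close> \<open>\<kappa> \<ge> 1\<close>
    by (intro exI[of _ a] exI[of _ b] exI[of _ \<kappa>] conjI ballI) simp_all
qed

text \<open>The term \<open>p t\<close> enters additively, so it can be moved to the argument of the
  inverse, leaving a map free of \<open>t\<close>.\<close>

lemma inv_map_perturbed_map:
  "inv_map (perturbed_map f p F t) y = inv_map (\<lambda>v. (+) (f v) ` F v) (y + p t)"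
proof -
  have "y = f v - p t + w \<longleftrightarrow> y + p t = f v + w" for v w
    by (simp add: algebra_simps)
  then show ?thesis
    unfolding inv_map_def perturbed_map_def by blast
qed

theorem theorem4p2p10:
  fixes f :: "real ^ 'n \<Rightarrow> real ^ 'n"
    and F :: "real ^ 'n \<Rightarrow> (real ^ 'n) set"
    and p z :: "real \<Rightarrow> real ^ 'n"
  assumes "continuous_on {0..1} z"
    and "\<And>t. t \<in> {0..1} \<Longrightarrow> z t \<in> solution_set f p F t"
    and "continuous_on {0..1} p"
    and "\<And>t. t \<in> {0..1} \<Longrightarrow> strongly_metrically_regular (perturbed_map f p F t) (z t) 0"
  shows "\<exists>a>0. \<exists>b>0. \<exists>\<kappa>>0. \<forall>t\<in>{0..1}.
           single_valued_lipschitz_on \<kappa> (cball 0 b)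
             (\<lambda>y. inv_map (perturbed_map f p F t) y \<inter> cball (z t) a)"
proof -
  define \<Phi> where "\<Phi> = inv_map (\<lambda>v. (+) (f v) ` F v)"
  \<comment> \<open>An equivalence, because it serves twice: it transfers the regularity assumption
    to \<open>\<Phi>\<close> and the uniform conclusion back.\<close>
  have shift: "single_valued_lipschitz_on \<kappa> (cball 0 b)
        (\<lambda>y. inv_map (perturbed_map f p F t) y \<inter> cball (z t) a) \<longleftrightarrow>
      single_valued_lipschitz_on \<kappa> (cball (p t) b) (\<lambda>y. \<Phi> y \<inter> cball (z t) a)" for \<kappa> a b t
    using single_valued_lipschitz_on_translate[of \<kappa> b "\<lambda>y. \<Phi> y \<inter> cball (z t) a" "p t"]
    by (simp add: inv_map_perturbed_map \<Phi>_def)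
  have graph: "z t \<in> \<Phi> (p t)" if "t \<in> {0..1}" for t
  proof -
    have "z t \<in> inv_map (perturbed_map f p F t) 0"
      using assms(2)[OF that] by (simp add: solution_set_def inv_map_def)
    then show ?thesis
      by (simp add: inv_map_perturbed_map \<Phi>_def)
  qed
  have reg: "\<exists>a>0. \<exists>b>0. \<exists>\<kappa>>0.
      single_valued_lipschitz_on \<kappa> (cball (p t) b) (\<lambda>y. \<Phi> y \<inter> cball (z t) a)"
    if "t \<in> {0..1}" for t
    using assms(4)[OF that] unfolding strongly_metrically_regular_def shift by blast
  show ?thesis
    unfolding shift
    using single_valued_lipschitz_on_uniform[OF compact_Icc assms(1,3) graph reg] .
qed

end
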